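(* Let $G=(V,E)$ be a locally finite connected weighted graph with $D_\mu<\infty$ which has the volume growth of positive degree $m$. Let $f:[0,+\infty)\to\mathbb{R}$ satisfy: $f$ is continuous in $[0,+\infty)$; $f(0)=0$ and $f(\tau)>0$ for all $\tau>0$; $f$ is convex in $[0,+\infty)$; and $\int_r^{+\infty}\frac{d\tau}{f(\tau)}<\infty$ for some $r>0$. Let $a:V\to\mathbb{R}$ be bounded, non-negative and not identically zero in $V$. Set $$F(r)=\int_r^{+\infty}\frac{d\tau}{f(\tau)}\qquad (r>0).$$ If there exists a $\theta\in(0,1)$ such that $$F(t^{-1})\le t^{\frac{\theta}{m}}$$ for all sufficiently large $t$, then the non-negative solution $u$ of the Cauchy problem $$\begin{cases}\frac{\partial}{\partial t}u(t,x)=\Delta u(t,x)+f(u(t,x)), & (t,x)\in(0,+\infty)\times V,\\ u(0,x)=a(x), & x\in V,\end{cases}$$ blows up in a finite time.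
   Context: Graph setting. $G=(V,E)$ is a graph with vertex set $V$ and edge set $E$; $y\sim x$ means $y$ is adjacent to $x$; locally finite means every vertex has finitely many neighbours. Edges carry weights $\omega:V\times V\to[0,\infty)$ with $\omega_{xy}=\omega_{yx}$ and $\omega_{xy}>0$ if and only if $x\sim y$. $\mu:V\to(0,\infty)$ is a positive measure on the vertices. Put $m(x)=\sum_{y\sim x}\omega_{xy}$ and $D_\mu=\sup_{x\in V}\frac{m(x)}{\mu(x)}$; it is assumed throughout that $D_\mu<\infty$. Laplacian. For $h:V\to\mathbb{R}$, the $\mu$-Laplacian is $\Delta h(x)=\frac{1}{\mu(x)}\sum_{y\sim x}\omega_{xy}(h(y)-h(x))$; $\Delta u(t,x)$ means $\Delta$ applied to $u(t,\cdot)$ at $x$. Volume growth. $d(x,y)$ is the graph distance (smallest number of edges of a path between $x$ and $y$), $B(x,r)=\{y\in V: d(x,y)\le r\}$, and $V(x,r)=\sum_{y\in B(x,r)}\mu(y)$. $G$ has the volume growth of positive degree $m$ ($m>0$ a real constant, unrelated to the function $m(x)$) if there is a constant $c_0>0$ such that $V(x,r)\le c_0r^m$ for all $x\in V$ and all $r\ge1$. Solutions and blow-up. For $T>0$, a function $u=u(t,x)$ is a solution in $[0,T]\times V$ if the problem is satisfied by $u$ in $[0,T]\times V$ and $u$ is bounded and continuous with respect to $t$ in $[0,T]\times V$. A solution $u$ (considered on its interval of existence) blows up in a finite time $T$ if there exists $x\in V$ such that $|u(t,x)|\to+\infty$ as $t\to T^-$; "blows up in a finite time" means this holds for some $T\i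n(0,+\infty)$.
   Formalization: The interval of existence, if finite, is assumed to end where u has no continuation satisfying the problem, even one unbounded over V; with bounded continuations only, the claim fails, since the supremum over V can become infinite while u stays bounded at every vertex. *)

theory Defs
  imports "HOL-Analysis.Analysis"
begin

text \<open>
  The vertex set is the type \<open>'v\<close>; \<open>E\<close> is the adjacency relation.
  Loops are not excluded (they do not affect the Laplacian).
\<close>

locale weighted_graph =
  fixes E :: "('v \<times> 'v) set"
    and \<omega> :: "'v \<Rightarrow> 'v \<Rightarrow> real"
    and \<mu> :: "'v \<Rightarrow> real"
  assumes adj_sym: "sym E"
    and weight_nonneg: "\<omega> x y \<ge> 0"
    and weight_sym: "\<omega> x y = \<omega> y x"
    and weight_pos_iff: "\<omega> x y > 0 \<longleftrightarrow> (x, y) \<in> E"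
    and measure_pos: "\<mu> x > 0"

definition locally_finite_graph :: "('v \<times> 'v) set \<Rightarrow> bool" where
  "locally_finite_graph E \<longleftrightarrow> (\<forall>x. finite (E `` {x}))"

definition connected_graph :: "('v \<times> 'v) set \<Rightarrow> bool" where
  "connected_graph E \<longleftrightarrow> (\<forall>x y. (x, y) \<in> E\<^sup>*)"

definition weighted_degree :: "('v \<times> 'v) set \<Rightarrow> ('v \<Rightarrow> 'v \<Rightarrow> real) \<Rightarrow> 'v \<Rightarrow> real" where
  "weighted_degree E \<omega> x = (\<Sum>y\<in>E `` {x}. \<omega> x y)"

definition D_mu :: "('v \<times> 'v) set \<Rightarrow> ('v \<Rightarrow> 'v \<Rightarrow> real) \<Rightarrow> ('v \<Rightarrow> real) \<Rightarrow> ereal" where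
  "D_mu E \<omega> \<mu> = (SUP x. ereal (weighted_degree E \<omega> x / \<mu> x))"

definition laplacian ::
  "('v \<times> 'v) set \<Rightarrow> ('v \<Rightarrow> 'v \<Rightarrow> real) \<Rightarrow> ('v \<Rightarrow> real) \<Rightarrow> ('v \<Rightarrow> real) \<Rightarrow> 'v \<Rightarrow> real" where
  "laplacian E \<omega> \<mu> h x = (1 / \<mu> x) * (\<Sum>y\<in>E `` {x}. \<omega> x y * (h y - h x))"

text \<open>A walk with \<open>n\<close> edges from \<open>x\<close> to \<open>y\<close> exists iff \<open>(x, y) \<in> E ^^ n\<close>.\<close>

definition graph_dist :: "('v \<times> 'v) set \<Rightarrow> 'v \<Rightarrow> 'v \<Rightarrow> nat" where
  "graph_dist E x y = (LEAST n. (x, y) \<in> E ^^ n)"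

definition graph_ball :: "('v \<times> 'v) set \<Rightarrow> 'v \<Rightarrow> real \<Rightarrow> 'v set" where
  "graph_ball E x r = {y. real (graph_dist E x y) \<le> r}"

definition volume :: "('v \<times> 'v) set \<Rightarrow> ('v \<Rightarrow> real) \<Rightarrow> 'v \<Rightarrow> real \<Rightarrow> real" where
  "volume E \<mu> x r = (\<Sum>y\<in>graph_ball E x r. \<mu> y)"

definition volume_growth :: "('v \<times> 'v) set \<Rightarrow> ('v \<Rightarrow> real) \<Rightarrow> real \<Rightarrow> bool" where
  "volume_growth E \<mu> m \<longleftrightarrow>
     (\<exists>c\<^sub>0>0. \<forall>x. \<forall>r\<ge>1. volume E \<mu> x r \<le> c\<^sub>0 * r powr m)"

definition F_tail :: "(real \<Rightarrow> real) \<Rightarrow> real \<Rightarrow> real" where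
  "F_tail f r = integral {r..} (\<lambda>\<tau>. 1 / f \<tau>)"

text \<open>The time derivative is one-sided at the right end point \<open>T\<close>.\<close>

definition satisfies_problem ::
  "('v \<times> 'v) set \<Rightarrow> ('v \<Rightarrow> 'v \<Rightarrow> real) \<Rightarrow> ('v \<Rightarrow> real) \<Rightarrow> (real \<Rightarrow> real) \<Rightarrow> ('v \<Rightarrow> real)
    \<Rightarrow> real \<Rightarrow> (real \<Rightarrow> 'v \<Rightarrow> real) \<Rightarrow> bool" where
  "satisfies_problem E \<omega> \<mu> f a T u \<longleftrightarrow>
     (\<forall>t\<in>{0<..T}. \<forall>x. ((\<lambda>s. u s x) has_real_derivative
         laplacian E \<omega> \<mu> (u t) x + f (u t x)) (at t within {0..T})) \<and>
     (\<forall>x. u 0 x = a x)"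

definition solution_on ::
  "('v \<times> 'v) set \<Rightarrow> ('v \<Rightarrow> 'v \<Rightarrow> real) \<Rightarrow> ('v \<Rightarrow> real) \<Rightarrow> (real \<Rightarrow> real) \<Rightarrow> ('v \<Rightarrow> real)
    \<Rightarrow> real \<Rightarrow> (real \<Rightarrow> 'v \<Rightarrow> real) \<Rightarrow> bool" where
  "solution_on E \<omega> \<mu> f a T u \<longleftrightarrow>
     satisfies_problem E \<omega> \<mu> f a T u \<and>
     bounded ((\<lambda>(t, x). u t x) ` ({0..T} \<times> UNIV)) \<and>
     (\<forall>x. continuous_on {0..T} (\<lambda>t. u t x))"

text \<open>
  \<open>[0, L)\<close>, with \<open>0 < L \<le> \<infinity>\<close>, is the interval of existence of \<open>u\<close>: \<open>u\<close> is a solution in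
  \<open>[0, T] \<times> V\<close> for every \<open>T < L\<close>, and, if \<open>L\<close> is finite, \<open>u\<close> cannot be continued to a function
  satisfying the problem up to and including time \<open>L\<close>. The continuation is not required to be
  bounded over all of \<open>V\<close>: the supremum over \<open>V\<close> may become infinite while every \<open>u(\<cdot>, x)\<close> stays
  bounded, and such a time is not a blow-up time in the vertexwise sense used below.
  Values \<open>u t x\<close> with \<open>t < 0\<close> or \<open>t \<ge> L\<close> are irrelevant.
\<close>

definition existence_interval ::
  "('v \<times> 'v) set \<Rightarrow> ('v \<Rightarrow> 'v \<Rightarrow> real) \<Rightarrow> ('v \<Rightarrow> real) \<Rightarrow> (real \<Rightarrow> real) \<Rightarrow> ('v \<Rightarrow> real)
    \<Rightarrow> ereal \<Rightarrow> (real \<Rightarrow> 'v \<Rightarrow> real) \<Rightarrow> bool" where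
  "existence_interval E \<omega> \<mu> f a L u \<longleftrightarrow>
     0 < L \<and>
     (\<forall>T>0. ereal T < L \<longrightarrow> solution_on E \<omega> \<mu> f a T u) \<and>
     (\<forall>T. L = ereal T \<longrightarrow>
        \<not> (\<exists>v. (\<forall>t\<in>{0..<T}. \<forall>x. v t x = u t x) \<and> satisfies_problem E \<omega> \<mu> f a T v))"

definition blows_up_at :: "(real \<Rightarrow> 'v \<Rightarrow> real) \<Rightarrow> real \<Rightarrow> bool" where
  "blows_up_at u T \<longleftrightarrow> (\<exists>x. filterlim (\<lambda>t. \<bar>u t x\<bar>) at_top (at_left T))"

text \<open>The condition \<open>T \<le> L\<close> keeps the limit inside the interval of existence \<open>[0, L)\<close>.\<close>

definition blows_up_in_finite_time :: "ereal \<Rightarrow> (real \<Rightarrow> 'v \<Rightarrow> real) \<Rightarrow> bool" where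
  "blows_up_in_finite_time L u \<longleftrightarrow> (\<exists>T>0. ereal T \<le> L \<and> blows_up_at u T)"

end

theory Submission
  imports Defs
begin

text \<open>
  Two independent facts give the theorem: a nonnegative solution cannot be global, and a finite end
  \<open>L\<close> of the interval of existence is always a blow-up time.

  \<^emph>\<open>No global solution.\<close> Fix a vertex \<open>z\<close> with \<open>a z > 0\<close> and a small \<open>\<epsilon> > 0\<close>, and average \<open>u\<close> with
  respect to the measure \<open>\<phi> \<mu>\<close>, where \<open>\<phi> x = (1 - \<epsilon>) ^ (2 * d(z, x))\<close>. Neighbours have distances to
  \<open>z\<close> that differ by at most one, so \<open>\<phi>\<close> is almost subharmonic,
  \<open>\<Delta>\<phi> \<ge> - 2 \<epsilon> D \<phi>\<close>, and Jensen's inequality turns the equation into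
  \<open>y' \<ge> f y - 2 \<epsilon> D y\<close> for the average \<open>y\<close>. Since \<open>f(s) / s\<close> is nondecreasing, this forces
  blow-up of \<open>y\<close> within time \<open>2 F(s)\<close> as soon as \<open>y 0 \<ge> s\<close> and \<open>f s \<ge> 8 \<epsilon> D s\<close>
  (\<open>differential_inequality_lifespan\<close>). Volume growth of degree \<open>m\<close> bounds the total mass of
  \<open>\<phi> \<mu>\<close> by a constant times \<open>\<epsilon> powr (- m)\<close> (\<open>damped_volume_le\<close>, \<open>weighted_volume_le\<close>), so \<open>s\<close> may be
  taken to be a constant times \<open>\<epsilon> powr m\<close>. The hypothesis on \<open>F\<close>, together with
  \<open>\<sigma> / f (2 \<sigma>) \<le> F \<sigma>\<close>, gives \<open>f s / s \<ge> (s / 2) powr (\<theta> / m) / 2\<close>, which is a constant times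
  \<open>\<epsilon> powr \<theta>\<close>; as \<open>\<theta> < 1\<close>, this dominates \<open>8 \<epsilon> D\<close> for small \<open>\<epsilon>\<close>.

  To work with finite sums only, the weight is cut off outside the ball of radius \<open>R\<close> around \<open>z\<close>.
  On \<open>[0, T]\<close> the solution is bounded, so the cut-off costs an error that decays exponentially in
  \<open>R\<close>, whereas the lifespan bound \<open>2 F(s)\<close> does not depend on \<open>R\<close>: first \<open>T > 2 F(s)\<close> is chosen and
  then \<open>R\<close> (\<open>weighted_sum_laplacian_ge\<close>, \<open>lifespan_le\<close>, \<open>no_global_solution\<close>).

  \<^emph>\<open>Finite interval of existence.\<close> Because \<open>\<Delta>u \<ge> - D u\<close>, the function \<open>exp (D t) u(t, x)\<close> is
  nondecreasing in \<open>t\<close>, so at each vertex \<open>u\<close> either tends to infinity or has a finite limit as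
  \<open>t\<close> tends to \<open>L\<close>. If all limits were finite, they would extend \<open>u\<close> to a function satisfying the
  problem up to and including time \<open>L\<close> (\<open>blow_up_at_end_of_existence\<close>).
\<close>

section \<open>Convex reaction terms and the comparison ordinary differential inequality\<close>

locale reaction_term =
  fixes f :: "real \<Rightarrow> real"
  assumes continuous: "continuous_on {0..} f"
    and zero: "f 0 = 0"
    and pos: "\<And>\<tau>. \<tau> > 0 \<Longrightarrow> f \<tau> > 0"
    and convex: "convex_on {0..} f"
    and tail: "\<exists>r>0. (\<lambda>\<tau>. 1 / f \<tau>) integrable_on {r..}"
begin

lemma nonneg: "0 \<le> z \<Longrightarrow> 0 \<le> f z"
  using zero pos[of z] by (cases "z = 0") auto

text \<open>
  The chord from the origin, where \<open>f\<close> vanishes, to \<open>(z, f z)\<close> lies above the graph, so \<open>f s / s\<close> is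
  nondecreasing in \<open>s\<close>; the quotients are cleared.
\<close>

lemma ratio_mono:
  assumes "0 < s" "s \<le> z"
  shows "f s * z \<le> f z * s"
proof -
  have "f ((1 - s / z) *\<^sub>R 0 + (s / z) *\<^sub>R z) \<le> (1 - s / z) * f 0 + (s / z) * f z"
    by (rule convex_onD[OF convex]) (use assms in auto)
  then have "f s \<le> (s / z) * f z"
    using assms zero by simp
  then show ?thesis
    using assms by (simp add: field_simps)
qed

lemma mono:
  assumes "0 < s" "s \<le> z"
  shows "f s \<le> f z"
proof -
  have "f s * z \<le> f z * s" by (rule ratio_mono[OF assms])
  also have "\<dots> \<le> f z * z"
    using assms nonneg[of z] by (intro mult_left_mono) auto
  finally show ?thesis using assms by simp
qed

lemma supporting_line:
  assumes "0 < s"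
  obtains k where "\<And>z. 0 \<le> z \<Longrightarrow> f s + k * (z - s) \<le> f z"
proof -
  have "s \<in> interior {0..}" using assms by (simp add: interior_Ici[where b = "-1"])
  from that[OF convex_le_Inf_differential[OF convex this]] show ?thesis by simp
qed

lemma inverse_continuous: "0 < a \<Longrightarrow> continuous_on {a..b} (\<lambda>\<tau>. 1 / f \<tau>)"
  by (intro continuous_intros continuous_on_subset[OF continuous])
     (use pos less_le_trans in \<open>force simp: less_imp_neq[THEN not_sym]\<close>)+

lemma tail_integrable:
  assumes "0 < s"
  shows "(\<lambda>\<tau>. 1 / f \<tau>) integrable_on {s..}"
proof -
  obtain r where r: "r > 0" "(\<lambda>\<tau>. 1 / f \<tau>) integrable_on {r..}" using tail by auto
  show ?thesis
  proof (cases "s \<le> r")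
    case True
    have "(\<lambda>\<tau>. 1 / f \<tau>) integrable_on {s..r} \<union> {r..}"
    proof (rule integrable_Un)
      have "{s..r} \<inter> {r..} \<subseteq> {r}" by auto
      then show "negligible ({s..r} \<inter> {r..})" using negligible_sing negligible_subset by blast
      show "(\<lambda>\<tau>. 1 / f \<tau>) integrable_on {s..r}"
        by (intro integrable_continuous_real inverse_continuous assms)
    qed (rule r)
    moreover have "{s..r} \<union> {r..} = {s..}" using True by auto
    ultimately show ?thesis by simp
  next
    case False
    have "(\<lambda>\<tau>. 1 / f \<tau>) absolutely_integrable_on {r..}"
      using r by (intro nonnegative_absolutely_integrable_1) (auto simp: nonneg)
    then have "(\<lambda>\<tau>. 1 / f \<tau>) absolutely_integrable_on {s..}"
      by (rule set_integrable_subset) (use False in auto)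
    then show ?thesis by (rule set_lebesgue_integral_eq_integral)
  qed
qed

lemma F_tail_nonneg: "0 < s \<Longrightarrow> 0 \<le> F_tail f s"
  unfolding F_tail_def
  by (intro integral_nonneg tail_integrable) (auto simp: nonneg)

lemma F_tail_split:
  assumes "0 < s" "s \<le> b"
  shows "F_tail f s = integral {s..b} (\<lambda>\<tau>. 1 / f \<tau>) + F_tail f b"
proof -
  have "{s..b} \<union> {b..} = {s..}" using assms by auto
  moreover have "integral ({s..b} \<union> {b..}) (\<lambda>\<tau>. 1 / f \<tau>)
      = integral {s..b} (\<lambda>\<tau>. 1 / f \<tau>) + integral {b..} (\<lambda>\<tau>. 1 / f \<tau>)"
  proof (rule integral_Un)
    have "{s..b} \<inter> {b..} \<subseteq> {b}" by auto
    then show "negligible ({s..b} \<inter> {b..})" using negligible_sing negligible_subset by blast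
    show "(\<lambda>\<tau>. 1 / f \<tau>) integrable_on {s..b}"
      by (intro integrable_continuous_real inverse_continuous assms)
    show "(\<lambda>\<tau>. 1 / f \<tau>) integrable_on {b..}"
      using assms by (intro tail_integrable) auto
  qed
  ultimately show ?thesis unfolding F_tail_def by simp
qed

lemma F_tail_antimono:
  assumes "0 < s" "s \<le> b"
  shows "F_tail f b \<le> F_tail f s"
proof -
  have "0 \<le> integral {s..b} (\<lambda>\<tau>. 1 / f \<tau>)"
    by (intro integral_nonneg integrable_continuous_real inverse_continuous assms)
       (use assms in \<open>auto simp: nonneg\<close>)
  then show ?thesis using F_tail_split[OF assms] by simp
qed

lemma F_tail_has_derivative:
  assumes "0 < z"
  shows "(F_tail f has_real_derivative - (1 / f z)) (at z)"
proof -
  let ?H = "\<lambda>x. integral {x..2 * z} (\<lambda>\<tau>. 1 / f \<tau>) + F_tail f (2 * z)"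
  have "((\<lambda>x. integral {x..2 * z} (\<lambda>\<tau>. 1 / f \<tau>)) has_real_derivative - (1 / f z))
      (at z within {z / 2..2 * z})"
    by (rule integral_has_real_derivative') (use assms in \<open>auto intro: inverse_continuous\<close>)
  then have "((\<lambda>x. integral {x..2 * z} (\<lambda>\<tau>. 1 / f \<tau>)) has_real_derivative - (1 / f z)) (at z)"
    using assms by (simp add: at_within_Icc_at)
  then have "(?H has_real_derivative - (1 / f z)) (at z)"
    by (auto intro!: derivative_eq_intros)
  then show ?thesis
  proof (rule has_field_derivative_transform_within_open)
    show "open {z / 2<..<2 * z}" "z \<in> {z / 2<..<2 * z}" using assms by auto
    show "?H x = F_tail f x" if "x \<in> {z / 2<..<2 * z}" for x
      using that assms F_tail_split[of x "2 * z"] by simp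
  qed
qed

text \<open>
  On \<open>[s, 2 s]\<close> the integrand is at least \<open>1 / f (2 s)\<close>. Read backwards, an upper bound on the tail
  integral is a lower bound on \<open>f\<close>.
\<close>

lemma F_tail_lower_bound:
  assumes "0 < s"
  shows "s / f (2 * s) \<le> F_tail f s"
proof -
  have "integral {s..2 * s} (\<lambda>\<tau>. 1 / f (2 * s)) \<le> integral {s..2 * s} (\<lambda>\<tau>. 1 / f \<tau>)"
  proof (rule integral_le)
    show "(\<lambda>\<tau>. 1 / f \<tau>) integrable_on {s..2 * s}"
      by (intro integrable_continuous_real inverse_continuous assms)
    show "1 / f (2 * s) \<le> 1 / f x" if "x \<in> {s..2 * s}" for x
      using that assms by (intro divide_left_mono mono mult_pos_pos pos) auto
  qed auto
  then show ?thesis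
    using F_tail_split[of s "2 * s"] F_tail_nonneg[of "2 * s"] assms by simp
qed

text \<open>
  Where \<open>y \<ge> s\<close>, the drift \<open>b y\<close> and the error \<open>d\<close> each use up at most a quarter of \<open>f y\<close>, by
  monotonicity of \<open>f s / s\<close> and of \<open>f\<close>. Hence \<open>y' \<ge> f y / 2\<close>, so \<open>F_tail f (y t)\<close> decreases at rate at
  least one half; being nonnegative, it can do so only for a time \<open>2 * F_tail f s\<close>.
\<close>

lemma differential_inequality_lifespan:
  assumes "0 < s" "0 \<le> b" "0 < T"
    and drift: "4 * b * s \<le> f s" and error: "4 * d \<le> f s"
    and cont: "continuous_on {0..T} y"
    and deriv: "\<And>t. 0 < t \<Longrightarrow> t < T \<Longrightarrow> (y has_real_derivative y' t) (at t)"
    and ineq: "\<And>t. 0 < t \<Longrightarrow> t < T \<Longrightarrow> f (y t) - b * y t - d \<le> y' t"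
    and y_nonneg: "\<And>t. 0 \<le> t \<Longrightarrow> t \<le> T \<Longrightarrow> 0 \<le> y t"
    and init: "s \<le> y 0"
  shows "T \<le> 2 * F_tail f s"
proof -
  obtain k where k: "\<And>z. 0 \<le> z \<Longrightarrow> f s + k * (z - s) \<le> f z"
    using supporting_line[OF \<open>0 < s\<close>] by blast
  have fs: "0 < f s" using pos assms by simp
  \<comment> \<open>The supporting line at \<open>s\<close> makes the inequality linear in \<open>y - s\<close>, so an integrating factor
    shows that \<open>y\<close> stays above \<open>s\<close>.\<close>
  have y_ge: "s \<le> y t" if t: "0 \<le> t" "t \<le> T" for t
  proof -
    let ?g = "\<lambda>r. exp (- (k - b) * r) * (y r - s)"
    have "?g 0 \<le> ?g t"
    proof (rule DERIV_nonneg_imp_increasing_open[OF t(1)])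
      fix r assume r: "0 < r" "r < t"
      have "(?g has_real_derivative exp (- (k - b) * r) * (y' r - (k - b) * (y r - s))) (at r)"
        using r t by (auto intro!: derivative_eq_intros deriv simp: algebra_simps)
      moreover have "0 \<le> y' r - (k - b) * (y r - s)"
      proof -
        have "f s + k * (y r - s) - b * y r - d \<le> y' r"
          using k[of "y r"] ineq[of r] y_nonneg[of r] r t by simp
        moreover have "0 \<le> f s - b * s - d" using drift error fs by simp
        ultimately show ?thesis by (simp add: algebra_simps)
      qed
      ultimately show "\<exists>z. (?g has_real_derivative z) (at r) \<and> 0 \<le> z" by fastforce
    next
      show "continuous_on {0..t} ?g"
        by (intro continuous_intros continuous_on_subset[OF cont]) (use t in auto)
    qed
    then have "0 \<le> ?g t" using init by simp
    then show ?thesis by (simp add: zero_le_mult_iff)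
  qed
  have y'_ge: "f (y t) / 2 \<le> y' t" if t: "0 < t" "t < T" for t
  proof -
    have ys: "s \<le> y t" using y_ge t by simp
    have "4 * b * s * y t \<le> f s * y t"
      using drift ys \<open>0 < s\<close> by (intro mult_right_mono) auto
    also have "\<dots> \<le> f (y t) * s" by (rule ratio_mono[OF \<open>0 < s\<close> ys])
    finally have "s * (4 * b * y t) \<le> s * f (y t)" by (simp add: mult_ac)
    then have "4 * b * y t \<le> f (y t)" using \<open>0 < s\<close> by simp
    moreover have "4 * d \<le> f (y t)" using error mono[OF \<open>0 < s\<close> ys] by simp
    ultimately show ?thesis using ineq[OF t] by simp
  qed
  let ?h = "\<lambda>t. - F_tail f (y t) - t / 2"
  have "?h 0 \<le> ?h T"
  proof (rule DERIV_nonneg_imp_increasing_open[of 0 T ?h])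
    show "0 \<le> T" using assms by simp
    fix t assume t: "0 < t" "t < T"
    have yt: "0 < y t" using y_ge[of t] t assms by simp
    have "((\<lambda>t. F_tail f (y t)) has_real_derivative - (1 / f (y t)) * y' t) (at t)"
      by (rule DERIV_chain2[OF F_tail_has_derivative[OF yt] deriv[OF t]])
    then have "(?h has_real_derivative y' t / f (y t) - 1 / 2) (at t)"
      by (auto intro!: derivative_eq_intros)
    moreover have "0 \<le> y' t / f (y t) - 1 / 2"
      using y'_ge[OF t] pos[OF yt] by (simp add: field_simps)
    ultimately show "\<exists>z. (?h has_real_derivative z) (at t) \<and> 0 \<le> z" by blast
  next
    have "continuous_on {0<..} (F_tail f)"
      by (rule DERIV_continuous_on)
         (use F_tail_has_derivative in \<open>auto intro: has_field_derivative_at_within\<close>)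
    then have "continuous_on {0..T} (\<lambda>t. F_tail f (y t))"
      by (rule continuous_on_compose2[OF _ cont]) (use y_ge \<open>0 < s\<close> in force)
    then show "continuous_on {0..T} ?h" by (intro continuous_intros) auto
  qed
  moreover have "0 \<le> F_tail f (y T)" using y_ge[of T] assms by (intro F_tail_nonneg) auto
  moreover have "F_tail f (y 0) \<le> F_tail f s" by (rule F_tail_antimono[OF \<open>0 < s\<close> init])
  ultimately show ?thesis by simp
qed

end

section \<open>Exponentially decaying weights on a graph of polynomial growth\<close>

locale bounded_degree_graph = weighted_graph E \<omega> \<mu>
  for E :: "('v \<times> 'v) set" and \<omega> \<mu> +
  fixes D :: real
  assumes finite_neighbours: "finite (E `` {x})"
    and connected: "(x, y) \<in> E\<^sup>*"
    and D_nonneg: "0 \<le> D"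
    and degree_le: "weighted_degree E \<omega> x \<le> D * \<mu> x"
begin

text \<open>
  A sum of weights over neighbours thus equals the sum over any finite set containing them, which
  makes double sums over a ball symmetric.
\<close>

lemma weight_zero: "(x, y) \<notin> E \<Longrightarrow> \<omega> x y = 0"
  using weight_pos_iff[of x y] weight_nonneg[of x y] by (auto simp: less_le)

lemma walk_graph_dist: "(x, y) \<in> E ^^ graph_dist E x y"
  unfolding graph_dist_def
  using connected[of x y] by (auto simp: rtrancl_power intro: LeastI_ex)

lemma graph_dist_self [simp]: "graph_dist E x x = 0"
  unfolding graph_dist_def by (simp add: Least_eq_0)

lemma graph_dist_neighbour: "(x, y) \<in> E \<Longrightarrow> graph_dist E z y \<le> Suc (graph_dist E z x)"
  using relcomp.relcompI[OF walk_graph_dist[of z x]]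
  by (subst (1) graph_dist_def, intro Least_le) auto

lemma finite_graph_ball [simp]: "finite (graph_ball E x (real R))"
proof -
  have fin: "finite ((E ^^ k) `` {x})" for k
  proof (induction k)
    case (Suc k)
    have "(E ^^ Suc k) `` {x} = (\<Union>y\<in>(E ^^ k) `` {x}. E `` {y})" by auto
    then show ?case using Suc finite_neighbours by simp
  qed simp
  have "graph_ball E x (real R) \<subseteq> (\<Union>k\<le>R. (E ^^ k) `` {x})"
    using walk_graph_dist[of x] by (force simp: graph_ball_def)
  then show ?thesis by (rule finite_subset) (auto simp: fin)
qed

lemma mu_laplacian:
  "\<mu> x * laplacian E \<omega> \<mu> h x = (\<Sum>y\<in>E `` {x}. \<omega> x y * h y) - weighted_degree E \<omega> x * h x"
  using measure_pos[of x]
  by (simp add: laplacian_def weighted_degree_def right_diff_distrib sum_subtractf sum_distrib_right)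

text \<open>
  Only the diagonal term of the Laplacian of a nonnegative function can be negative.
\<close>

lemma laplacian_ge:
  assumes "\<And>y. 0 \<le> h y"
  shows "- D * h x \<le> laplacian E \<omega> \<mu> h x"
proof -
  have "- D * \<mu> x * h x \<le> - weighted_degree E \<omega> x * h x"
    using degree_le[of x] assms by (simp add: mult_right_mono)
  also have "\<dots> \<le> \<mu> x * laplacian E \<omega> \<mu> h x"
    unfolding mu_laplacian using assms by (simp add: sum_nonneg weight_nonneg)
  finally have "\<mu> x * (- D * h x) \<le> \<mu> x * laplacian E \<omega> \<mu> h x"
    by (simp add: mult_ac)
  then show ?thesis using measure_pos[of x] by (simp only: mult_le_cancel_left_pos)
qed

text \<open>
  Summation by parts moves the Laplacian onto the weight \<open>q ^ n\<close>. Along an edge \<open>n\<close> grows by at most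
  one, so the weight shrinks at most by the factor \<open>q\<close>: this accounts for the term with \<open>1 - q\<close>.
  The cut-off is felt only on the sphere \<open>n = R\<close>, where some neighbours lie outside the ball; there
  the whole diagonal term is given away, at the cost \<open>D * M * q ^ R\<close> per unit of measure.
\<close>

lemma weighted_sum_laplacian_ge:
  fixes z :: 'v and R :: nat and h :: "'v \<Rightarrow> real"
  assumes h: "\<And>x. 0 \<le> h x" "\<And>x. h x \<le> M" and q: "0 \<le> q" "q \<le> 1"
  defines "n \<equiv> graph_dist E z" and "A \<equiv> graph_ball E z (real R)"
  shows "- (1 - q) * D * (\<Sum>x\<in>A. q ^ n x * \<mu> x * h x) - D * M * (q ^ R * volume E \<mu> z (real R))
    \<le> (\<Sum>x\<in>A. q ^ n x * \<mu> x * laplacian E \<omega> \<mu> h x)"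
proof -
  have A: "finite A" unfolding A_def by simp
  have A_iff: "x \<in> A \<longleftrightarrow> n x \<le> R" for x unfolding A_def n_def graph_ball_def by simp
  have M: "0 \<le> M" using h[of z] by simp
  have deg_nonneg: "0 \<le> weighted_degree E \<omega> x" for x
    unfolding weighted_degree_def by (intro sum_nonneg weight_nonneg)
  have local: "- (1 - q) * D * (q ^ n x * \<mu> x * h x) - D * M * (q ^ R * \<mu> x)
      \<le> h x * (\<Sum>y\<in>A. \<omega> x y * q ^ n y) - q ^ n x * weighted_degree E \<omega> x * h x" if x: "x \<in> A" for x
  proof (cases "n x < R")
    case True
    then have sub: "E `` {x} \<subseteq> A"
      using graph_dist_neighbour[of x _ z] by (fastforce simp: A_iff n_def)
    have "q ^ Suc (n x) * weighted_degree E \<omega> x = (\<Sum>y\<in>E `` {x}. \<omega> x y * q ^ Suc (n x))"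
      unfolding weighted_degree_def by (simp add: sum_distrib_left mult_ac)
    also have "\<dots> \<le> (\<Sum>y\<in>E `` {x}. \<omega> x y * q ^ n y)"
      using graph_dist_neighbour[of x _ z]
      by (intro sum_mono mult_left_mono power_decreasing weight_nonneg q) (auto simp: n_def)
    also have "\<dots> \<le> (\<Sum>y\<in>A. \<omega> x y * q ^ n y)"
      using q by (intro sum_mono2 A sub) (auto intro!: mult_nonneg_nonneg weight_nonneg)
    finally have "h x * (q ^ Suc (n x) * weighted_degree E \<omega> x) \<le> h x * (\<Sum>y\<in>A. \<omega> x y * q ^ n y)"
      by (intro mult_left_mono h)
    moreover have "(1 - q) * (q ^ n x * h x) * weighted_degree E \<omega> x
        \<le> (1 - q) * (q ^ n x * h x) * (D * \<mu> x)"
      using q h by (intro mult_left_mono degree_le) auto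
    moreover have "0 \<le> D * M * (q ^ R * \<mu> x)"
      using D_nonneg M q measure_pos[of x] by (intro mult_nonneg_nonneg) auto
    ultimately show ?thesis by (simp add: algebra_simps)
  next
    case False
    then have nx: "n x = R" using x by (simp add: A_iff)
    have "0 \<le> h x * (\<Sum>y\<in>A. \<omega> x y * q ^ n y)"
      using q h by (intro mult_nonneg_nonneg sum_nonneg) (auto intro!: weight_nonneg)
    moreover have "weighted_degree E \<omega> x * h x \<le> (D * \<mu> x) * M"
      using h measure_pos[of x] D_nonneg deg_nonneg by (intro mult_mono degree_le) auto
    then have "q ^ R * (weighted_degree E \<omega> x * h x) \<le> q ^ R * (D * \<mu> x * M)"
      using q by (intro mult_left_mono) auto
    moreover have "0 \<le> (1 - q) * D * (q ^ n x * \<mu> x * h x)"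
      using q h D_nonneg measure_pos[of x] by (intro mult_nonneg_nonneg) auto
    ultimately show ?thesis unfolding nx by (simp add: algebra_simps)
  qed
  have "- (1 - q) * D * (\<Sum>x\<in>A. q ^ n x * \<mu> x * h x) - D * M * (q ^ R * volume E \<mu> z (real R))
      = (\<Sum>x\<in>A. - (1 - q) * D * (q ^ n x * \<mu> x * h x) - D * M * (q ^ R * \<mu> x))"
    by (simp only: volume_def A_def sum_subtractf sum_distrib_left)
  also have "\<dots> \<le> (\<Sum>x\<in>A. h x * (\<Sum>y\<in>A. \<omega> x y * q ^ n y) - q ^ n x * weighted_degree E \<omega> x * h x)"
    by (intro sum_mono local)
  also have "\<dots> = (\<Sum>x\<in>A. \<Sum>y\<in>A. \<omega> x y * q ^ n y * h x)
      - (\<Sum>x\<in>A. q ^ n x * weighted_degree E \<omega> x * h x)"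
    by (simp add: sum_subtractf sum_distrib_left mult_ac)
  also have "(\<Sum>x\<in>A. \<Sum>y\<in>A. \<omega> x y * q ^ n y * h x) = (\<Sum>x\<in>A. \<Sum>y\<in>A. \<omega> x y * q ^ n x * h y)"
    by (subst sum.swap) (simp add: weight_sym)
  also have "\<dots> = (\<Sum>x\<in>A. q ^ n x * (\<Sum>y\<in>A. \<omega> x y * h y))"
    by (simp add: sum_distrib_left mult_ac)
  \<comment> \<open>Edges leaving the ball contribute nonnegatively because \<open>h \<ge> 0\<close>.\<close>
  also have "\<dots> \<le> (\<Sum>x\<in>A. q ^ n x * (\<Sum>y\<in>E `` {x}. \<omega> x y * h y))"
  proof (intro sum_mono mult_left_mono)
    fix x
    have "(\<Sum>y\<in>A. \<omega> x y * h y) = (\<Sum>y\<in>A \<inter> E `` {x}. \<omega> x y * h y)"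
      by (rule sum.mono_neutral_right) (auto simp: A weight_zero)
    also have "\<dots> \<le> (\<Sum>y\<in>E `` {x}. \<omega> x y * h y)"
      by (intro sum_mono2 finite_neighbours) (auto intro!: mult_nonneg_nonneg weight_nonneg h)
    finally show "(\<Sum>y\<in>A. \<omega> x y * h y) \<le> (\<Sum>y\<in>E `` {x}. \<omega> x y * h y)" .
  qed (use q in auto)
  also have "(\<Sum>x\<in>A. q ^ n x * (\<Sum>y\<in>E `` {x}. \<omega> x y * h y))
        - (\<Sum>x\<in>A. q ^ n x * weighted_degree E \<omega> x * h x)
      = (\<Sum>x\<in>A. q ^ n x * \<mu> x * laplacian E \<omega> \<mu> h x)"
    by (simp add: mult.assoc mu_laplacian sum_subtractf right_diff_distrib)
  finally show ?thesis by simp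
qed

lemma weighted_volume_by_parts:
  "(\<Sum>x\<in>graph_ball E z (real R). q ^ graph_dist E z x * \<mu> x)
    = q ^ R * volume E \<mu> z (real R) + (1 - q) * (\<Sum>k<R. q ^ k * volume E \<mu> z (real k))"
proof (induction R)
  case 0
  have "graph_dist E z x = 0" if "x \<in> graph_ball E z 0" for x
    using that by (simp add: graph_ball_def)
  then show ?case by (simp add: volume_def)
next
  case (Suc R)
  let ?S = "{x. graph_dist E z x = Suc R}"
  have split: "graph_ball E z (real (Suc R)) = graph_ball E z (real R) \<union> ?S"
    by (auto simp: graph_ball_def)
  have "?S \<subseteq> graph_ball E z (real (Suc R))" unfolding split by blast
  then have fin: "finite ?S" by (rule finite_subset) (rule finite_graph_ball)
  have sum: "sum g (graph_ball E z (real (Suc R))) = sum g (graph_ball E z (real R)) + sum g ?S"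
    for g :: "'v \<Rightarrow> real"
    unfolding split
    by (rule sum.union_disjoint) (use fin finite_graph_ball in \<open>auto simp: graph_ball_def\<close>)
  have "(\<Sum>x\<in>?S. q ^ graph_dist E z x * \<mu> x) = q ^ Suc R * sum \<mu> ?S"
    unfolding sum_distrib_left by (rule sum.cong) auto
  also have "sum \<mu> ?S = volume E \<mu> z (real (Suc R)) - volume E \<mu> z (real R)"
    unfolding volume_def sum by simp
  finally show ?case
    unfolding sum Suc.IH by (simp add: algebra_simps)
qed

text \<open>
  Exponential decay beats polynomial growth: \<open>x powr m * exp (- \<epsilon> * x)\<close> is at most
  \<open>(m / \<epsilon>) powr m\<close>, since \<open>v \<le> exp v\<close> for \<open>v = \<epsilon> * x / m\<close>. It is used at \<open>x = k + 1\<close> because the volume growth is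
  assumed only for radii at least one; the shift costs the factor \<open>exp 1\<close>.
\<close>

lemma damped_volume_le:
  assumes vol: "\<And>r. 1 \<le> r \<Longrightarrow> volume E \<mu> z r \<le> c * r powr m"
    and "0 < c" "0 < m" "0 < \<epsilon>" "\<epsilon> < 1"
  shows "(1 - \<epsilon>) ^ k * volume E \<mu> z (real k) \<le> c * exp 1 * (m / \<epsilon>) powr m"
proof -
  let ?x = "real (Suc k)"
  have "volume E \<mu> z (real k) \<le> volume E \<mu> z ?x"
    unfolding volume_def
    by (intro sum_mono2 finite_graph_ball) (auto simp: graph_ball_def less_imp_le[OF measure_pos])
  also have "\<dots> \<le> c * ?x powr m" by (rule vol) simp
  finally have V: "volume E \<mu> z (real k) \<le> c * ?x powr m" .
  have "(1 - \<epsilon>) ^ k \<le> exp (- \<epsilon>) ^ k"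
    using assms exp_ge_add_one_self[of "- \<epsilon>"] by (intro power_mono) auto
  also have "\<dots> = exp \<epsilon> * exp (- \<epsilon> * ?x)"
    by (simp add: exp_of_nat_mult[symmetric] exp_add[symmetric] algebra_simps)
  also have "\<dots> \<le> exp 1 * exp (- \<epsilon> * ?x)"
    using assms by (intro mult_right_mono) auto
  finally have P: "(1 - \<epsilon>) ^ k \<le> exp 1 * exp (- \<epsilon> * ?x)" .
  have "(\<epsilon> * ?x / m) powr m \<le> exp (\<epsilon> * ?x / m) powr m"
  proof (rule powr_mono2)
    show "\<epsilon> * ?x / m \<le> exp (\<epsilon> * ?x / m)"
      using exp_ge_add_one_self[of "\<epsilon> * ?x / m"] by linarith
  qed (use assms in auto)
  also have "\<dots> = exp (\<epsilon> * ?x)" using assms by (simp add: powr_def)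
  finally have X: "(\<epsilon> * ?x / m) powr m \<le> exp (\<epsilon> * ?x)" .
  have "?x = (\<epsilon> * ?x / m) * (m / \<epsilon>)" using assms by simp
  then have "?x powr m = (\<epsilon> * ?x / m) powr m * (m / \<epsilon>) powr m"
    using assms powr_mult[of "\<epsilon> * ?x / m" "m / \<epsilon>" m] by simp
  also have "\<dots> \<le> exp (\<epsilon> * ?x) * (m / \<epsilon>) powr m"
    by (intro mult_right_mono X) auto
  finally have Y: "?x powr m \<le> exp (\<epsilon> * ?x) * (m / \<epsilon>) powr m" .
  have "(1 - \<epsilon>) ^ k * volume E \<mu> z (real k)
      \<le> (exp 1 * exp (- \<epsilon> * ?x)) * (c * (exp (\<epsilon> * ?x) * (m / \<epsilon>) powr m))"
  proof (rule mult_mono[OF P])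
    show "volume E \<mu> z (real k) \<le> c * (exp (\<epsilon> * ?x) * (m / \<epsilon>) powr m)"
      using V mult_left_mono[OF Y, of c] assms by linarith
    show "0 \<le> volume E \<mu> z (real k)"
      unfolding volume_def by (intro sum_nonneg less_imp_le measure_pos)
  qed auto
  also have "\<dots> = c * exp 1 * (m / \<epsilon>) powr m * (exp (- \<epsilon> * ?x) * exp (\<epsilon> * ?x))"
    by (simp only: mult_ac)
  also have "exp (- \<epsilon> * ?x) * exp (\<epsilon> * ?x) = 1"
    by (simp add: exp_add[symmetric])
  finally show ?thesis by simp
qed

text \<open>
  The base is squared so that one factor \<open>(1 - \<epsilon>) ^ k\<close> tames the volume of the ball of radius \<open>k\<close>
  while the other leaves a geometric series of sum \<open>1 / \<epsilon>\<close>. The factor \<open>1 - (1 - \<epsilon>)\<^sup>2 \<le> 2 * \<epsilon>\<close> from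
  summation by parts cancels that sum, so no power of \<open>1 / \<epsilon>\<close> is lost beyond those in \<open>B\<close>.
\<close>

lemma weighted_volume_le:
  assumes B: "\<And>k. (1 - \<epsilon>) ^ k * volume E \<mu> z (real k) \<le> B" and \<epsilon>: "0 < \<epsilon>" "\<epsilon> < 1"
  shows "(\<Sum>x\<in>graph_ball E z (real R). ((1 - \<epsilon>)\<^sup>2) ^ graph_dist E z x * \<mu> x) \<le> 3 * B"
proof -
  let ?q = "(1 - \<epsilon>)\<^sup>2"
  have V: "0 \<le> volume E \<mu> z r" for r
    unfolding volume_def by (intro sum_nonneg less_imp_le measure_pos)
  have B0: "0 \<le> B" using B[of 0] V[of 0] by simp
  have summand: "?q ^ k * volume E \<mu> z (real k) \<le> (1 - \<epsilon>) ^ k * B" for k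
  proof -
    have sq: "?q ^ k = (1 - \<epsilon>) ^ k * (1 - \<epsilon>) ^ k"
      by (simp only: power2_eq_square power_mult_distrib)
    show ?thesis
      unfolding sq mult.assoc by (rule mult_left_mono[OF B]) (use \<epsilon> in auto)
  qed
  have "?q ^ R * volume E \<mu> z (real R) \<le> B"
    using summand[of R] \<epsilon> B0 mult_right_mono[OF power_le_one[of "1 - \<epsilon>" R], of B] by simp
  moreover have "(1 - ?q) * (\<Sum>k<R. ?q ^ k * volume E \<mu> z (real k)) \<le> 2 * B"
  proof -
    have "\<epsilon> * (\<Sum>k<R. (1 - \<epsilon>) ^ k) = 1 - (1 - \<epsilon>) ^ R"
      using sum_gp_strict[of "1 - \<epsilon>" R] \<epsilon> by simp
    then have geo: "\<epsilon> * (\<Sum>k<R. (1 - \<epsilon>) ^ k) \<le> 1" using \<epsilon> by simp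
    have "(\<Sum>k<R. ?q ^ k * volume E \<mu> z (real k)) \<le> (\<Sum>k<R. (1 - \<epsilon>) ^ k) * B"
      unfolding sum_distrib_right by (intro sum_mono summand)
    moreover have "0 \<le> (\<Sum>k<R. ?q ^ k * volume E \<mu> z (real k))"
      by (intro sum_nonneg mult_nonneg_nonneg V) auto
    moreover have "1 - ?q \<le> 2 * \<epsilon>" by (simp add: power2_eq_square algebra_simps)
    ultimately have "(1 - ?q) * (\<Sum>k<R. ?q ^ k * volume E \<mu> z (real k))
        \<le> (2 * \<epsilon>) * ((\<Sum>k<R. (1 - \<epsilon>) ^ k) * B)"
      using \<epsilon> by (intro mult_mono) auto
    also have "\<dots> = 2 * (\<epsilon> * (\<Sum>k<R. (1 - \<epsilon>) ^ k)) * B" by simp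
    also have "\<dots> \<le> 2 * 1 * B"
      using geo B0 by (intro mult_right_mono) auto
    finally show ?thesis by simp
  qed
  ultimately show ?thesis unfolding weighted_volume_by_parts by simp
qed

end

section \<open>Global solutions cannot exist\<close>

locale reaction_diffusion = bounded_degree_graph E \<omega> \<mu> D + reaction_term f
  for E :: "('v \<times> 'v) set" and \<omega> \<mu> D f +
  fixes a :: "'v \<Rightarrow> real"
begin

lemma solution_derivative:
  assumes "solution_on E \<omega> \<mu> f a T u" "0 < t" "t < T"
  shows "((\<lambda>s. u s x) has_real_derivative laplacian E \<omega> \<mu> (u t) x + f (u t x)) (at t)"
proof -
  have "((\<lambda>s. u s x) has_real_derivative laplacian E \<omega> \<mu> (u t) x + f (u t x))
      (at t within {0..T})"
    using assms unfolding solution_on_def satisfies_problem_def by auto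
  then show ?thesis using assms by (simp add: at_within_Icc_at)
qed

text \<open>
  The average of \<open>u\<close> over a large ball, with weight \<open>((1 - \<epsilon>)\<^sup>2) ^ n\<close> and normalised to total mass one,
  satisfies the differential inequality above: Jensen's inequality handles the reaction term and
  \<open>weighted_sum_laplacian_ge\<close> the diffusion. The mass is at most \<open>3 * B\<close> for every radius, so the
  vertex \<open>z\<close> alone makes the initial average at least \<open>s\<close>.
\<close>

lemma lifespan_le:
  assumes sol: "solution_on E \<omega> \<mu> f a T u" and "0 < T"
    and u_nonneg: "\<And>t x. 0 \<le> t \<Longrightarrow> t \<le> T \<Longrightarrow> 0 \<le> u t x"
    and a_nonneg: "\<And>x. 0 \<le> a x"
    and \<epsilon>: "0 < \<epsilon>" "\<epsilon> < 1"
    and B: "\<And>k. (1 - \<epsilon>) ^ k * volume E \<mu> z (real k) \<le> B"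
    and s: "0 < s" "3 * B * s \<le> a z * \<mu> z"
    and drift: "8 * \<epsilon> * D * s \<le> f s"
  shows "T \<le> 2 * F_tail f s"
proof -
  have "bounded ((\<lambda>(t, x). u t x) ` ({0..T} \<times> UNIV))"
    using sol unfolding solution_on_def by simp
  then obtain M where "\<forall>y\<in>(\<lambda>(t, x). u t x) ` ({0..T} \<times> UNIV). norm y \<le> M"
    unfolding bounded_iff by blast
  then have M: "u t x \<le> M" if "0 \<le> t" "t \<le> T" for t x
  proof -
    have "u t x \<in> (\<lambda>(t, x). u t x) ` ({0..T} \<times> UNIV)" using that by force
    then have "norm (u t x) \<le> M" using \<open>\<forall>y\<in>_. norm y \<le> M\<close> by blast
    then show ?thesis by simp
  qed
  have "0 \<le> M" using u_nonneg[of 0 z] M[of 0 z] \<open>0 < T\<close> by simp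
  have fs: "0 < f s" using pos s by simp
  have muz: "0 < \<mu> z" by (rule measure_pos)
  have "0 \<le> B" using B[of 0] sum_nonneg[of "graph_ball E z (real 0)" \<mu>] measure_pos
    by (auto simp: volume_def less_imp_le intro: order_trans)
  \<comment> \<open>\<open>R\<close> may depend on the bound \<open>M\<close>, hence on \<open>T\<close>, since \<open>s\<close> and \<open>\<epsilon>\<close> do not depend on \<open>R\<close>.\<close>
  have "(\<lambda>R. D * M * B / \<mu> z * (1 - \<epsilon>) ^ R) \<longlonglongrightarrow> D * M * B / \<mu> z * 0"
    using \<epsilon> by (intro tendsto_intros) auto
  then have "eventually (\<lambda>R. D * M * B / \<mu> z * (1 - \<epsilon>) ^ R < f s / 4) sequentially"
    by (rule order_tendstoD) (use fs in simp)
  then obtain R where R: "D * M * B / \<mu> z * (1 - \<epsilon>) ^ R < f s / 4"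
    by (auto simp: eventually_sequentially)
  define q where "q = (1 - \<epsilon>)\<^sup>2"
  define A where "A = graph_ball E z (real R)"
  define \<phi> where "\<phi> x = q ^ graph_dist E z x * \<mu> x" for x
  define W where "W = sum \<phi> A"
  define p where "p x = \<phi> x / W" for x
  define y where "y t = (\<Sum>x\<in>A. p x * u t x)" for t
  define y' where "y' t = (\<Sum>x\<in>A. p x * (laplacian E \<omega> \<mu> (u t) x + f (u t x)))" for t
  have q: "0 < q" "q \<le> 1" "1 - q \<le> 2 * \<epsilon>"
    using \<epsilon> by (auto simp: q_def power_le_one) (simp add: power2_eq_square algebra_simps)
  have A: "finite A" "z \<in> A" by (auto simp: A_def) (simp add: graph_ball_def)
  have \<phi>_pos: "0 < \<phi> x" for x using q measure_pos[of x] by (simp add: \<phi>_def)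
  have W_le: "W \<le> 3 * B"
    unfolding W_def \<phi>_def q_def A_def by (rule weighted_volume_le[OF B \<epsilon>])
  have \<phi>z: "\<phi> z = \<mu> z" by (simp add: \<phi>_def)
  have W_ge: "\<mu> z \<le> W"
    unfolding W_def \<phi>z[symmetric] by (rule member_le_sum) (use A \<phi>_pos less_imp_le in auto)
  have W: "0 < W" using W_ge muz by simp
  have p_nonneg: "0 \<le> p x" for x using \<phi>_pos[of x] W by (simp add: p_def)
  have p_sum: "sum p A = 1" using W by (simp add: p_def W_def sum_divide_distrib[symmetric])
  show ?thesis
  proof (rule differential_inequality_lifespan[where y = y and y' = y' and b = "2 * \<epsilon> * D"
        and d = "D * M * B / \<mu> z * (1 - \<epsilon>) ^ R"])
    show "0 < s" "0 < T" by fact+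
    show "0 \<le> 2 * \<epsilon> * D" using \<epsilon> D_nonneg by simp
    show "4 * (2 * \<epsilon> * D) * s \<le> f s" using drift by simp
    show "4 * (D * M * B / \<mu> z * (1 - \<epsilon>) ^ R) \<le> f s" using R by linarith
    show "continuous_on {0..T} y"
      unfolding y_def using sol by (intro continuous_intros) (auto simp: solution_on_def)
    show "0 \<le> y t" if "0 \<le> t" "t \<le> T" for t
      unfolding y_def using that by (intro sum_nonneg mult_nonneg_nonneg p_nonneg u_nonneg)
    have u0: "u 0 x = a x" for x
      using sol unfolding solution_on_def satisfies_problem_def by simp
    have "s * W \<le> s * (3 * B)" using W_le s(1) by simp
    also have "\<dots> \<le> a z * \<mu> z" using s(2) by (simp add: mult_ac)
    finally have "s \<le> p z * u 0 z"
      using W unfolding p_def \<phi>z u0 by (simp add: field_simps)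
    also have "\<dots> \<le> y 0"
      unfolding y_def by (rule member_le_sum) (use A p_nonneg a_nonneg u0 in auto)
    finally show "s \<le> y 0" .
  next
    fix t assume t: "0 < t" "t < T"
    show "(y has_real_derivative y' t) (at t)"
      unfolding y_def y'_def
      by (auto intro!: derivative_eq_intros solution_derivative[OF sol t] sum.cong)
    have ut: "0 \<le> u t x" "u t x \<le> M" for x using t u_nonneg M by auto
    have "f (y t) \<le> (\<Sum>x\<in>A. p x * f (u t x))"
      using convex_on_sum[OF A(1) _ convex p_sum p_nonneg, of "u t"] A ut
      by (auto simp: y_def)
    moreover have "- (2 * \<epsilon> * D) * y t - D * M * B / \<mu> z * (1 - \<epsilon>) ^ R
        \<le> (\<Sum>x\<in>A. p x * laplacian E \<omega> \<mu> (u t) x)"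
    proof -
      have boundary: "q ^ R * volume E \<mu> z (real R) / W \<le> B / \<mu> z * (1 - \<epsilon>) ^ R"
      proof -
        have "q ^ R = (1 - \<epsilon>) ^ R * (1 - \<epsilon>) ^ R"
          by (simp only: q_def power2_eq_square power_mult_distrib)
        then have "q ^ R * volume E \<mu> z (real R)
            = (1 - \<epsilon>) ^ R * ((1 - \<epsilon>) ^ R * volume E \<mu> z (real R))" by simp
        also have "\<dots> \<le> (1 - \<epsilon>) ^ R * B"
          by (rule mult_left_mono[OF B]) (use \<epsilon> in auto)
        finally have "q ^ R * volume E \<mu> z (real R) / W \<le> (1 - \<epsilon>) ^ R * B / W"
          using W by (simp add: divide_right_mono)
        also have "\<dots> \<le> (1 - \<epsilon>) ^ R * B / \<mu> z"
          using W W_ge muz \<open>0 \<le> B\<close> \<epsilon> by (intro divide_left_mono) auto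
        finally show ?thesis by (simp add: mult_ac)
      qed
      have "0 \<le> y t" unfolding y_def by (intro sum_nonneg mult_nonneg_nonneg p_nonneg ut)
      then have "- (2 * \<epsilon> * D) * y t - D * M * B / \<mu> z * (1 - \<epsilon>) ^ R
          \<le> - (1 - q) * D * y t - D * M * (q ^ R * volume E \<mu> z (real R) / W)"
        using mult_right_mono[OF q(3), of "D * y t"] mult_left_mono[OF boundary, of "D * M"]
          D_nonneg \<open>0 \<le> M\<close> by (simp add: algebra_simps)
      also have "\<dots> = (- (1 - q) * D * (\<Sum>x\<in>A. \<phi> x * u t x)
          - D * M * (q ^ R * volume E \<mu> z (real R))) / W"
        by (simp add: y_def p_def diff_divide_distrib sum_divide_distrib sum_distrib_left)
      also have "\<dots> \<le> (\<Sum>x\<in>A. \<phi> x * laplacian E \<omega> \<mu> (u t) x) / W"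
        unfolding \<phi>_def A_def
        by (intro divide_right_mono weighted_sum_laplacian_ge ut) (use q W in auto)
      also have "\<dots> = (\<Sum>x\<in>A. p x * laplacian E \<omega> \<mu> (u t) x)"
        by (simp add: p_def sum_divide_distrib)
      finally show ?thesis .
    qed
    ultimately show "f (y t) - 2 * \<epsilon> * D * y t - D * M * B / \<mu> z * (1 - \<epsilon>) ^ R \<le> y' t"
      unfolding y'_def by (simp add: distrib_left sum.distrib)
  qed
qed

text \<open>
  With \<open>\<sigma> = \<kappa> * \<epsilon> powr m\<close>, the initial average is at least \<open>s = 2 * \<sigma>\<close>. The bound on the tail integral gives
  \<open>f (2 * \<sigma>) \<ge> \<sigma> * \<sigma> powr (\<theta> / m)\<close>, where \<open>\<sigma> powr (\<theta> / m)\<close> is of order \<open>\<epsilon> powr \<theta>\<close> and so exceeds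
  \<open>16 * D * \<epsilon>\<close> for small \<open>\<epsilon>\<close>. This is where \<open>\<theta> < 1\<close> enters.
\<close>

lemma no_global_solution:
  assumes sol: "\<And>T. 0 < T \<Longrightarrow> solution_on E \<omega> \<mu> f a T u"
    and u_nonneg: "\<And>t x. 0 \<le> t \<Longrightarrow> 0 \<le> u t x"
    and a: "\<And>x. 0 \<le> a x" "a z \<noteq> 0"
    and "0 < m" and growth: "volume_growth E \<mu> m"
    and \<theta>: "0 < \<theta>" "\<theta> < 1"
    and tail_bound: "eventually (\<lambda>t. F_tail f (1 / t) \<le> t powr (\<theta> / m)) at_top"
  shows False
proof -
  obtain c where c: "c > 0" and vol: "\<And>x r. 1 \<le> r \<Longrightarrow> volume E \<mu> x r \<le> c * r powr m"
    using growth unfolding volume_growth_def by blast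
  have az: "0 < a z" using a(1)[of z] a(2) by simp
  have muz: "0 < \<mu> z" by (rule measure_pos)
  define C where "C = c * exp 1 * m powr m"
  define \<kappa> where "\<kappa> = a z * \<mu> z / (6 * C)"
  have C: "0 < C" using c \<open>0 < m\<close> by (simp add: C_def)
  have \<kappa>: "0 < \<kappa>" using C az muz by (simp add: \<kappa>_def)
  obtain N where N: "\<And>t. N \<le> t \<Longrightarrow> F_tail f (1 / t) \<le> t powr (\<theta> / m)"
    using tail_bound unfolding eventually_at_top_linorder by blast
  have small: "((\<lambda>\<epsilon>. K * \<epsilon> powr r) \<longlongrightarrow> 0) (at_right 0)" if "0 < r" for K r :: real
  proof -
    have "((\<lambda>\<epsilon>. K * \<epsilon> powr r) \<longlongrightarrow> K * 0 powr r) (at_right 0)"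
      using that
      by (intro tendsto_mult tendsto_const tendsto_powr' tendsto_ident_at)
         (auto simp: eventually_at_right_less intro: eventually_at_rightI[of 0 1])
    then show ?thesis by simp
  qed
  have "eventually (\<lambda>\<epsilon>. 0 < \<epsilon> \<and> \<epsilon> < 1) (at_right (0::real))"
    by (rule eventually_at_rightI[of 0 1]) auto
  moreover have "eventually (\<lambda>\<epsilon>. \<kappa> * \<epsilon> powr m < 1 / max N 1) (at_right 0)"
    by (rule order_tendstoD(2)[OF small]) (use \<open>0 < m\<close> in auto)
  moreover have "eventually (\<lambda>\<epsilon>. (16 * D) * \<epsilon> powr (1 - \<theta>) < \<kappa> powr (\<theta> / m)) (at_right 0)"
    by (rule order_tendstoD(2)[OF small]) (use \<theta> \<kappa> in auto)
  ultimately have "eventually (\<lambda>\<epsilon>. (0 < \<epsilon> \<and> \<epsilon> < 1) \<and> \<kappa> * \<epsilon> powr m < 1 / max N 1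
      \<and> (16 * D) * \<epsilon> powr (1 - \<theta>) < \<kappa> powr (\<theta> / m)) (at_right 0)"
    by eventually_elim auto
  then obtain \<epsilon> where \<epsilon>: "0 < \<epsilon>" "\<epsilon> < 1"
    and \<epsilon>N: "\<kappa> * \<epsilon> powr m < 1 / max N 1"
    and \<epsilon>D: "(16 * D) * \<epsilon> powr (1 - \<theta>) < \<kappa> powr (\<theta> / m)"
    using eventually_happens'[OF trivial_limit_at_right_real] by blast
  define \<sigma> where "\<sigma> = \<kappa> * \<epsilon> powr m"
  have \<sigma>: "0 < \<sigma>" using \<kappa> \<epsilon> by (simp add: \<sigma>_def)
  have fpos: "0 < f (2 * \<sigma>)" using pos \<sigma> by simp
  have "max N 1 < 1 / \<sigma>"
    using \<epsilon>N \<sigma> unfolding \<sigma>_def[symmetric]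
    by (simp add: less_divide_eq mult.commute del: max_less_iff_conj)
  then have "F_tail f \<sigma> \<le> (1 / \<sigma>) powr (\<theta> / m)" using N[of "1 / \<sigma>"] by simp
  then have "\<sigma> / f (2 * \<sigma>) \<le> 1 / \<sigma> powr (\<theta> / m)"
    using F_tail_lower_bound[OF \<sigma>] \<sigma> by (simp add: powr_divide)
  then have f_ge: "\<sigma> * \<sigma> powr (\<theta> / m) \<le> f (2 * \<sigma>)"
    using \<sigma> fpos by (simp add: field_simps)
  have "16 * D * \<epsilon> = (16 * D * \<epsilon> powr (1 - \<theta>)) * \<epsilon> powr \<theta>"
    using \<epsilon> by (simp add: powr_add[symmetric])
  also have "\<dots> \<le> \<kappa> powr (\<theta> / m) * \<epsilon> powr \<theta>"
    using \<epsilon>D by (intro mult_right_mono) auto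
  also have "\<dots> = \<sigma> powr (\<theta> / m)"
    using \<open>0 < m\<close> \<kappa> \<epsilon> by (simp add: \<sigma>_def powr_mult powr_powr)
  finally have "\<sigma> * (16 * D * \<epsilon>) \<le> \<sigma> * \<sigma> powr (\<theta> / m)"
    using \<sigma> by simp
  then have drift: "8 * \<epsilon> * D * (2 * \<sigma>) \<le> f (2 * \<sigma>)"
    using f_ge by (simp add: mult_ac)
  define B where "B = c * exp 1 * (m / \<epsilon>) powr m"
  have B: "(1 - \<epsilon>) ^ k * volume E \<mu> z (real k) \<le> B" for k
    unfolding B_def by (rule damped_volume_le[OF vol c \<open>0 < m\<close> \<epsilon>])
  have "B * \<epsilon> powr m = C"
    using \<epsilon> \<open>0 < m\<close> by (simp add: B_def C_def powr_divide)
  then have "3 * B * (2 * \<sigma>) = 6 * C * \<kappa>" by (simp add: \<sigma>_def mult_ac)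
  then have init: "3 * B * (2 * \<sigma>) \<le> a z * \<mu> z" using C by (simp add: \<kappa>_def)
  let ?T = "2 * F_tail f (2 * \<sigma>) + 1"
  have "0 < ?T" using F_tail_nonneg[of "2 * \<sigma>"] \<sigma> by simp
  then have "?T \<le> 2 * F_tail f (2 * \<sigma>)"
    by (intro lifespan_le[OF sol _ _ _ \<epsilon> B _ init drift] u_nonneg a) (use \<sigma> in auto)
  then show False by simp
qed

section \<open>A finite interval of existence ends in blow-up\<close>

text \<open>
  L'Hopital's rule for the difference quotient at \<open>T\<close>.
\<close>

lemma has_left_derivative_of_limit:
  fixes g g' :: "real \<Rightarrow> real"
  assumes "0 < T" and cont: "(g \<longlongrightarrow> g T) (at_left T)"
    and deriv: "\<And>t. 0 < t \<Longrightarrow> t < T \<Longrightarrow> (g has_real_derivative g' t) (at t)"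
    and lim: "(g' \<longlongrightarrow> l) (at_left T)"
  shows "(g has_real_derivative l) (at T within {0..T})"
proof -
  have ev: "eventually (\<lambda>t. 0 < t \<and> t < T) (at_left T)"
    by (rule eventually_at_leftI[of 0]) (use \<open>0 < T\<close> in auto)
  have "((\<lambda>t. (g t - g T) / (t - T)) \<longlongrightarrow> l) (at_left T)"
  proof (rule lhopital_left[where f' = g' and g' = "\<lambda>_. 1"])
    show "((\<lambda>t. g t - g T) \<longlongrightarrow> 0) (at_left T)"
      using tendsto_diff[OF cont tendsto_const[of "g T"]] by simp
    show "((\<lambda>t. t - T) \<longlongrightarrow> 0) (at_left T)"
      using tendsto_diff[OF tendsto_ident_at[of T] tendsto_const[of T]] by simp
    show "eventually (\<lambda>t. t - T \<noteq> 0) (at_left T)"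
      using ev by eventually_elim auto
    show "eventually (\<lambda>t. ((\<lambda>t. g t - g T) has_real_derivative g' t) (at t)) (at_left T)"
      using ev by eventually_elim (auto intro!: derivative_eq_intros deriv)
    show "eventually (\<lambda>t. ((\<lambda>t. t - T) has_real_derivative 1) (at t)) (at_left T)"
      by (intro always_eventually allI) (auto intro!: derivative_eq_intros)
    show "((\<lambda>t. g' t / 1) \<longlongrightarrow> l) (at_left T)" using lim by simp
  qed auto
  then show ?thesis
    using \<open>0 < T\<close> by (simp add: has_field_derivative_iff at_within_Icc_at_left)
qed

text \<open>
  The function \<open>exp (D * t) * u t x\<close> is nondecreasing, because diffusion removes mass from a vertex at
  relative rate at most \<open>D\<close> and the reaction term is nonnegative.
\<close>

lemma limit_or_blow_up:
  assumes sol: "\<And>T'. 0 < T' \<Longrightarrow> T' < T \<Longrightarrow> solution_on E \<omega> \<mu> f a T' u"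
    and u_nonneg: "\<And>t x. 0 \<le> t \<Longrightarrow> t < T \<Longrightarrow> 0 \<le> u t x"
    and "0 < T"
  shows "(\<exists>l. ((\<lambda>t. u t x) \<longlongrightarrow> l) (at_left T)) \<or> filterlim (\<lambda>t. \<bar>u t x\<bar>) at_top (at_left T)"
proof -
  define g where "g t = exp (D * t) * u t x" for t
  have g_mono: "g r \<le> g t" if "0 < r" "r \<le> t" "t < T" for r t
  proof (rule DERIV_nonneg_imp_nondecreasing[OF \<open>r \<le> t\<close>])
    fix w assume w: "r \<le> w" "w \<le> t"
    obtain T' where T': "w < T'" "T' < T" using dense[OF le_less_trans[OF w(2) \<open>t < T\<close>]] by blast
    have d: "((\<lambda>s. u s x) has_real_derivative laplacian E \<omega> \<mu> (u w) x + f (u w x)) (at w)"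
      by (rule solution_derivative[OF sol]) (use T' w that in auto)
    have "(g has_real_derivative
        exp (D * w) * (D * u w x + laplacian E \<omega> \<mu> (u w) x + f (u w x))) (at w)"
      unfolding g_def by (auto intro!: derivative_eq_intros d simp: algebra_simps)
    moreover have uw: "0 \<le> u w y" for y using u_nonneg w that by simp
    have "0 \<le> D * u w x + laplacian E \<omega> \<mu> (u w) x + f (u w x)"
      using laplacian_ge[of "u w" x, OF uw] nonneg[OF uw[of x]] by simp
    ultimately show "\<exists>y. (g has_real_derivative y) (at w) \<and> 0 \<le> y" by fastforce
  qed
  have u_eq: "u t x = exp (- D * t) * g t" for t
    by (simp add: g_def mult.assoc[symmetric] exp_add[symmetric])
  have at_left: "at T within ({..<T} \<inter> {0<..}) = at_left T"
    by (rule at_within_nhd[of T "{0<..}"]) (use \<open>0 < T\<close> in auto)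
  show ?thesis
  proof (cases "\<exists>K. \<forall>t. 0 < t \<longrightarrow> t < T \<longrightarrow> g t \<le> K")
    case True
    then obtain K where K: "\<And>t. 0 < t \<Longrightarrow> t < T \<Longrightarrow> g t \<le> K" by blast
    have "(g \<longlongrightarrow> Sup (g ` ({..<T} \<inter> {0<..}))) (at T within ({..<T} \<inter> {0<..}))"
      by (rule Lim_left_bound[where K = K]) (auto intro: g_mono K)
    then have "((\<lambda>t. exp (- D * t) * g t) \<longlongrightarrow> exp (- D * T) * Sup (g ` ({..<T} \<inter> {0<..})))
        (at_left T)"
      unfolding at_left by (intro tendsto_intros)
    then show ?thesis unfolding u_eq[symmetric] by blast
  next
    case False
    have "filterlim (\<lambda>t. \<bar>u t x\<bar>) at_top (at_left T)"
      unfolding filterlim_at_top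
    proof
      fix Z
      obtain r where r: "0 < r" "r < T" "exp (D * T) * Z < g r" using False not_less by metis
      have "Z \<le> \<bar>u t x\<bar>" if t: "r < t" "t < T" for t
      proof (cases "Z \<le> 0")
        case Z: False
        have "Z = exp (- D * t) * (exp (D * t) * Z)"
          by (simp add: mult.assoc[symmetric] exp_add[symmetric])
        also have "\<dots> \<le> exp (- D * t) * (exp (D * T) * Z)"
          using Z t D_nonneg by (intro mult_left_mono mult_right_mono) (auto intro: mult_left_mono)
        also have "\<dots> \<le> exp (- D * t) * g t"
          using r t g_mono[of r t] by (intro mult_left_mono) auto
        finally show ?thesis using u_eq[of t] by simp
      qed auto
      then show "eventually (\<lambda>t. Z \<le> \<bar>u t x\<bar>) (at_left T)"
        by (intro eventually_at_leftI[of r]) (use r in auto)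
    qed
    then show ?thesis ..
  qed
qed

text \<open>
  If \<open>u\<close> has a finite limit at every vertex, then, every vertex having finitely many neighbours, the
  right-hand side of the equation converges as well; its limit is the left derivative of the
  extension by limits, which contradicts the maximality of the interval of existence.
\<close>

lemma blow_up_at_end_of_existence:
  assumes ex: "existence_interval E \<omega> \<mu> f a (ereal T) u"
    and u_nonneg: "\<And>t x. 0 \<le> t \<Longrightarrow> t < T \<Longrightarrow> 0 \<le> u t x"
  shows "blows_up_at u T"
proof (rule ccontr)
  assume no_blow_up: "\<not> blows_up_at u T"
  have "0 < T" and sol: "\<And>T'. 0 < T' \<Longrightarrow> T' < T \<Longrightarrow> solution_on E \<omega> \<mu> f a T' u"
    and max: "\<not> (\<exists>v. (\<forall>t\<in>{0..<T}. \<forall>x. v t x = u t x) \<and> satisfies_problem E \<omega> \<mu> f a T v)"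
    using ex unfolding existence_interval_def by simp_all
  have "\<exists>l. ((\<lambda>t. u t x) \<longlongrightarrow> l) (at_left T)" for x
    using limit_or_blow_up[OF sol u_nonneg \<open>0 < T\<close>, of x] no_blow_up
    unfolding blows_up_at_def by blast
  then obtain l where l: "\<And>x. ((\<lambda>t. u t x) \<longlongrightarrow> l x) (at_left T)" by metis
  have ev: "eventually (\<lambda>t. 0 < t \<and> t < T) (at_left T)"
    by (rule eventually_at_leftI[of 0]) (use \<open>0 < T\<close> in auto)
  have l_nonneg: "0 \<le> l x" for x
    by (rule tendsto_lowerbound[OF l]) (use ev in eventually_elim, use u_nonneg in auto)
  define v where "v t = (if t < T then u t else l)" for t
  have v_deriv: "((\<lambda>s. v s x) has_real_derivative laplacian E \<omega> \<mu> (v t) x + f (v t x)) (at t)"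
    if t: "0 < t" "t < T" for t x
  proof -
    obtain T' where T': "t < T'" "T' < T" using dense[OF t(2)] by auto
    have "((\<lambda>s. u s x) has_real_derivative laplacian E \<omega> \<mu> (u t) x + f (u t x)) (at t)"
      by (rule solution_derivative[OF sol]) (use T' t in auto)
    then have "((\<lambda>s. v s x) has_real_derivative laplacian E \<omega> \<mu> (u t) x + f (u t x)) (at t)"
      by (rule has_field_derivative_transform_within_open[where S = "{..<T}"])
         (use t in \<open>auto simp: v_def\<close>)
    then show ?thesis using t by (simp add: v_def)
  qed
  have v_lim: "((\<lambda>t. v t x) \<longlongrightarrow> v T x) (at_left T)" for x
  proof -
    have "((\<lambda>t. v t x) \<longlongrightarrow> l x) (at_left T)"
      by (rule Lim_transform_eventually[OF l[of x]])
         (use ev in eventually_elim, auto simp: v_def)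
    then show ?thesis by (simp add: v_def)
  qed
  have lap_lim: "((\<lambda>t. laplacian E \<omega> \<mu> (v t) x) \<longlongrightarrow> laplacian E \<omega> \<mu> (v T) x) (at_left T)" for x
    unfolding laplacian_def by (intro tendsto_intros v_lim)
  have f_lim: "((\<lambda>t. f (v t x)) \<longlongrightarrow> f (v T x)) (at_left T)" for x
  proof (rule continuous_on_tendsto_compose[OF continuous v_lim])
    show "v T x \<in> {0..}" by (simp add: v_def l_nonneg)
    show "eventually (\<lambda>t. v t x \<in> {0..}) (at_left T)"
      using ev by eventually_elim (simp add: v_def u_nonneg)
  qed
  have end_deriv: "((\<lambda>s. v s x) has_real_derivative laplacian E \<omega> \<mu> (v T) x + f (v T x))
      (at T within {0..T})" for x
    by (rule has_left_derivative_of_limit[OF \<open>0 < T\<close> v_lim v_deriv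
          tendsto_add[OF lap_lim f_lim]])
  have "u 0 x = a x" for x
    using sol[of "T / 2"] \<open>0 < T\<close> unfolding solution_on_def satisfies_problem_def by simp
  moreover have "((\<lambda>s. v s x) has_real_derivative laplacian E \<omega> \<mu> (v t) x + f (v t x))
      (at t within {0..T})" if "t \<in> {0<..T}" for t x
    using that end_deriv[of x] v_deriv[of t x]
    by (cases "t = T") (auto intro: has_field_derivative_at_within)
  ultimately have "satisfies_problem E \<omega> \<mu> f a T v"
    unfolding satisfies_problem_def using \<open>0 < T\<close> by (simp add: v_def[of 0])
  moreover have "\<forall>t\<in>{0..<T}. \<forall>x. v t x = u t x" by (simp add: v_def)
  ultimately show False using max by blast
qed

end

section \<open>Blow-up of nonnegative solutions\<close>

lemma degree_bound:
  assumes "weighted_graph E \<omega> \<mu>" and "D_mu E \<omega> \<mu> < \<infinity>"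
  obtains D where "0 \<le> D" and "\<And>x. weighted_degree E \<omega> x \<le> D * \<mu> x"
proof -
  interpret weighted_graph E \<omega> \<mu> by fact
  obtain D where D: "D_mu E \<omega> \<mu> \<le> ereal D"
    using assms(2) by (cases "D_mu E \<omega> \<mu>") auto
  have quotient: "weighted_degree E \<omega> x / \<mu> x \<le> D" for x
    using D SUP_upper[of x UNIV "\<lambda>x. ereal (weighted_degree E \<omega> x / \<mu> x)"]
    unfolding D_mu_def by (metis UNIV_I ereal_less_eq(3) order_trans)
  have le: "weighted_degree E \<omega> x \<le> D * \<mu> x" for x
    using measure_pos[of x] quotient[of x] by (simp add: pos_divide_le_eq)
  have "weighted_degree E \<omega> x \<le> max D 0 * \<mu> x" for x
    by (rule order_trans[OF le mult_right_mono]) (use measure_pos[of x] in auto)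
  then show ?thesis using that[of "max D 0"] by simp
qed

theorem theorem1p1:
  fixes E :: "('v \<times> 'v) set"
    and \<omega> :: "'v \<Rightarrow> 'v \<Rightarrow> real"
    and \<mu> a :: "'v \<Rightarrow> real"
    and f :: "real \<Rightarrow> real"
    and m \<theta> :: real
    and L :: ereal
    and u :: "real \<Rightarrow> 'v \<Rightarrow> real"
  assumes "weighted_graph E \<omega> \<mu>"
    and "locally_finite_graph E"
    and "connected_graph E"
    and "D_mu E \<omega> \<mu> < \<infinity>"
    and "m > 0"
    and "volume_growth E \<mu> m"
    and "continuous_on {0..} f"
    and "f 0 = 0"
    and "\<And>\<tau>. \<tau> > 0 \<Longrightarrow> f \<tau> > 0"
    and "convex_on {0..} f"
    and "\<exists>r>0. (\<lambda>\<tau>. 1 / f \<tau>) integrable_on {r..}"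
    and "bounded (range a)"
    and "\<And>x. a x \<ge> 0"
    and "\<exists>x. a x \<noteq> 0"
    and "0 < \<theta>" and "\<theta> < 1"
    and "eventually (\<lambda>t. F_tail f (1 / t) \<le> t powr (\<theta> / m)) at_top"
    and "existence_interval E \<omega> \<mu> f a L u"
    and "\<And>t x. 0 \<le> t \<Longrightarrow> ereal t < L \<Longrightarrow> u t x \<ge> 0"
  shows "blows_up_in_finite_time L u"
proof -
  obtain D where D: "0 \<le> D" "\<And>x. weighted_degree E \<omega> x \<le> D * \<mu> x"
    using degree_bound[OF assms(1,4)] by blast
  interpret weighted_graph E \<omega> \<mu> by fact
  interpret reaction_diffusion E \<omega> \<mu> D f a
    by unfold_locales
      (use D assms in \<open>auto simp: locally_finite_graph_def connected_graph_def\<close>)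
  obtain z where z: "a z \<noteq> 0" using assms by blast
  show ?thesis
  proof (cases L)
    case (real T)
    then have "blows_up_at u T"
      using assms by (intro blow_up_at_end_of_existence) auto
    moreover have "0 < T" using assms(18) real by (simp add: existence_interval_def)
    ultimately show ?thesis unfolding blows_up_in_finite_time_def real by auto
  next
    case PInf
    then have "\<And>T. 0 < T \<Longrightarrow> solution_on E \<omega> \<mu> f a T u"
      using assms(18) by (simp add: existence_interval_def)
    moreover have "\<And>t x. 0 \<le> t \<Longrightarrow> 0 \<le> u t x" using assms(19) PInf by simp
    ultimately have False
      using no_global_solution[OF _ _ assms(13) z assms(5,6,15,16,17)] by blast
    then show ?thesis ..
  next
    case MInf
    then show ?thesis using assms(18) by (simp add: existence_interval_def)
  qed
qed

end
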